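(* The inverse semigroup $M(X)$ is not a quasi-isometry invariant of metric spaces: there exist quasi-isometric metric spaces $X$ and $Y$ such that the inverse semigroups $M(X)$ and $M(Y)$ are not isomorphic.
   Context: The inverse semigroup $M(X)$ of a metric space $(X,d_X)$: the double of $X$ is $X\sqcup X'$, where $X=X\times\{0\}$ and $X'=X\times\{1\}$ are two copies of $X$; write $x=(x,0)$ and $x'=(x,1)$. Let $\mathcal M(X)$ be the set of all metrics $d$ on $X\sqcup X'$ whose restriction to each of the two copies of $X$ is $d_X$ and which satisfy $\inf_{x,y\in X}d(x,y')>0$. Two metrics $b,d$ on a set $Z$ are coarsely equivalent if there are monotone functions $\varphi,\psi:[0,\infty)\to[0,\infty)$ with $\lim_{t\to\infty}\varphi(t)=\lim_{t\to\infty}\psi(t)=\infty$ such that $\varphi(d(z_1,z_2))\le b(z_1,z_2)\le\psi(d(z_1,z_2))$ for all $z_1,z_2\in Z$; $[d]$ denotes the coarse equivalence class of $d$. $M(X)$ is the set of coarse equivalence classes of metrics in $\mathcal M(X)$, with multiplication $[\rho][d]=[\rho\circ d]$, where $\rho\circ d\in\mathcal M(X)$ is determined by $(\rho\circ d)(x,z')=\inf_{y\in X}[d(x,y')+\rho(y,z')]$ for $x,z\in X$. It is known that this is well defined and that $M(X)$ is an inverse semigroup. *)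

theory Defs
  imports "HOL-Analysis.Abstract_Metric_Spaces" "HOL-Algebra.Group"
begin

text \<open>
  A metric space is a carrier set \<open>X\<close> with a distance function \<open>dX\<close> satisfying \<open>Metric_space X dX\<close>.
  Its double is the disjoint sum \<open>X <+> X\<close>: \<open>Inl x\<close> is the point \<open>x\<close> of the first copy and \<open>Inr x\<close>
  is the point \<open>x'\<close> of the second copy.
\<close>

definition quasi_isometric ::
  "'a set \<Rightarrow> ('a \<Rightarrow> 'a \<Rightarrow> real) \<Rightarrow> 'b set \<Rightarrow> ('b \<Rightarrow> 'b \<Rightarrow> real) \<Rightarrow> bool" where
  "quasi_isometric X dX Y dY \<longleftrightarrow>
    (\<exists>f \<in> X \<rightarrow> Y. \<exists>L C. L \<ge> 1 \<and> C \<ge> 0 \<and>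
      (\<forall>x\<in>X. \<forall>y\<in>X. dX x y / L - C \<le> dY (f x) (f y) \<and> dY (f x) (f y) \<le> L * dX x y + C) \<and>
      (\<forall>y\<in>Y. \<exists>x\<in>X. dY (f x) y \<le> C))"

definition coarsely_equivalent ::
  "'z set \<Rightarrow> ('z \<Rightarrow> 'z \<Rightarrow> real) \<Rightarrow> ('z \<Rightarrow> 'z \<Rightarrow> real) \<Rightarrow> bool" where
  "coarsely_equivalent Z b d \<longleftrightarrow>
    (\<exists>\<phi> \<psi>. \<phi> \<in> {0..} \<rightarrow> {0..} \<and> \<psi> \<in> {0..} \<rightarrow> {0..} \<and> mono_on {0..} \<phi> \<and> mono_on {0..} \<psi> \<and>
      filterlim \<phi> at_top at_top \<and> filterlim \<psi> at_top at_top \<and>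
      (\<forall>z1\<in>Z. \<forall>z2\<in>Z. \<phi> (d z1 z2) \<le> b z1 z2 \<and> b z1 z2 \<le> \<psi> (d z1 z2)))"

text \<open>
  The set of metrics on the double, written \<open>\<M>(X)\<close> in the literature. The infimum is a real one, so
  this definition is only meaningful for nonempty \<open>X\<close>.
\<close>

definition double_metrics ::
  "'a set \<Rightarrow> ('a \<Rightarrow> 'a \<Rightarrow> real) \<Rightarrow> ('a + 'a \<Rightarrow> 'a + 'a \<Rightarrow> real) set" where
  "double_metrics X dX = {d. Metric_space (X <+> X) d \<and>
    (\<forall>x\<in>X. \<forall>y\<in>X. d (Inl x) (Inl y) = dX x y \<and> d (Inr x) (Inr y) = dX x y) \<and>
    (INF (x, y)\<in>X \<times> X. d (Inl x) (Inr y)) > 0}"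

definition coarse_rel ::
  "'a set \<Rightarrow> ('a \<Rightarrow> 'a \<Rightarrow> real) \<Rightarrow> ('a + 'a \<Rightarrow> 'a + 'a \<Rightarrow> real) rel" where
  "coarse_rel X dX = {(b, d). b \<in> double_metrics X dX \<and> d \<in> double_metrics X dX \<and>
    coarsely_equivalent (X <+> X) b d}"

text \<open>
  \<open>double_comp X dX \<rho> d\<close> is \<open>\<rho> \<circ> d\<close>, with \<open>d\<close> applied first, as in \<open>[\<rho>][d] = [\<rho> \<circ> d]\<close>.
\<close>

fun double_comp ::
  "'a set \<Rightarrow> ('a \<Rightarrow> 'a \<Rightarrow> real) \<Rightarrow> ('a + 'a \<Rightarrow> 'a + 'a \<Rightarrow> real) \<Rightarrow> ('a + 'a \<Rightarrow> 'a + 'a \<Rightarrow> real) \<Rightarrow>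
    'a + 'a \<Rightarrow> 'a + 'a \<Rightarrow> real" where
  "double_comp X dX \<rho> d (Inl x) (Inl z) = dX x z"
| "double_comp X dX \<rho> d (Inr x) (Inr z) = dX x z"
| "double_comp X dX \<rho> d (Inl x) (Inr z) = (INF y\<in>X. d (Inl x) (Inr y) + \<rho> (Inl y) (Inr z))"
| "double_comp X dX \<rho> d (Inr z) (Inl x) = (INF y\<in>X. d (Inl x) (Inr y) + \<rho> (Inl y) (Inr z))"

fun double_unit :: "('a \<Rightarrow> 'a \<Rightarrow> real) \<Rightarrow> 'a + 'a \<Rightarrow> 'a + 'a \<Rightarrow> real" where
  "double_unit dX (Inl x) (Inl y) = dX x y"
| "double_unit dX (Inr x) (Inr y) = dX x y"
| "double_unit dX (Inl x) (Inr y) = dX x y + 1"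
| "double_unit dX (Inr x) (Inl y) = dX x y + 1"

text \<open>
  The inverse semigroup \<open>M(X)\<close>. The product of two classes is the class of \<open>\<rho> \<circ> d\<close>; as the class does
  not depend on the representatives, the union below is over a single set. The field \<open>one\<close> is there
  only because the record type demands it (it is the class of \<open>d(x, y') = dX(x, y) + 1\<close>, the neutral
  element of \<open>M(X)\<close>); the isomorphism relation \<open>\<cong>\<close> of \<^theory>\<open>HOL-Algebra.Group\<close> refers to
  \<open>carrier\<close> and \<open>mult\<close> alone, so it is isomorphism of semigroups.
\<close>

definition metric_semigroup ::
  "'a set \<Rightarrow> ('a \<Rightarrow> 'a \<Rightarrow> real) \<Rightarrow> ('a + 'a \<Rightarrow> 'a + 'a \<Rightarrow> real) set monoid" where
  "metric_semigroup X dX = \<lparr>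
    carrier = double_metrics X dX // coarse_rel X dX,
    mult = (\<lambda>A B. \<Union>\<rho>\<in>A. \<Union>d\<in>B. coarse_rel X dX `` {double_comp X dX \<rho> d}),
    one = coarse_rel X dX `` {double_unit dX}\<rparr>"

end

theory Submission
  imports Defs
begin

text \<open>
  If a subset \<open>X\<close> of the line contains \<open>0\<close> and its points have pairwise widely separated absolute
  values, then every metric \<open>d\<close> on the double is coarsely diagonal: since \<open>d(0, 0')\<close> is a constant,
  a bound on \<open>d(x, y')\<close> bounds \<open>\<bar>\<bar>x\<bar> - \<bar>y\<bar>\<bar>\<close>, and hence \<open>\<bar>x - y\<bar>\<close>. Up to bounded displacement
  the two factors of a product can then be exchanged, so \<open>M(X)\<close> is commutative. This applies to
  \<open>X = {0} \<union> {(-2)^n}\<close>. Halving the negative points is a bi-Lipschitz map of \<open>X\<close> onto the symmetric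
  set \<open>Y = {0} \<union> {\<plusminus>4^n}\<close>, where the reflection does not commute with the idempotent of the
  positive half, so \<open>M(Y)\<close> is not commutative.
\<close>

section \<open>Coarse equivalence\<close>

text \<open>One half of coarse equivalence, without control functions: the identity from
  \<open>d\<close> to \<open>b\<close> is bornologous. Comparing two metrics then amounts to finding
  one number \<open>D\<close> for each \<open>C\<close>.\<close>

definition coarsely_controlled ::
  "'z set \<Rightarrow> ('z \<Rightarrow> 'z \<Rightarrow> real) \<Rightarrow> ('z \<Rightarrow> 'z \<Rightarrow> real) \<Rightarrow> bool" where
  "coarsely_controlled Z b d \<longleftrightarrow> (\<forall>C. \<exists>D. \<forall>z1\<in>Z. \<forall>z2\<in>Z. d z1 z2 \<le> C \<longrightarrow> b z1 z2 \<le> D)"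

lemma coarsely_controlled_refl: "coarsely_controlled Z b b"
  unfolding coarsely_controlled_def by blast

lemma coarsely_controlled_trans:
  assumes "coarsely_controlled Z a b" "coarsely_controlled Z b c"
  shows "coarsely_controlled Z a c"
  using assms unfolding coarsely_controlled_def by meson

lemma controlled_imp_upper_bound:
  assumes b: "\<And>z1 z2. 0 \<le> b z1 z2" and ctrl: "coarsely_controlled Z b d"
  obtains \<psi> where "\<psi> \<in> {0..} \<rightarrow> {0..}" "mono_on {0..} \<psi>" "filterlim \<psi> at_top at_top"
    "\<forall>z1\<in>Z. \<forall>z2\<in>Z. b z1 z2 \<le> \<psi> (d z1 z2)"
proof -
  \<comment> \<open>The entry \<open>max 0 t\<close> keeps the set nonempty and the supremum
    nonnegative, and drives \<open>\<psi>\<close> to infinity even if \<open>b\<close> is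
    bounded.\<close>
  define S where "S t = insert (max 0 t) {b z1 z2 | z1 z2. z1 \<in> Z \<and> z2 \<in> Z \<and> d z1 z2 \<le> t}" for t
  define \<psi> where "\<psi> t = Sup (S t)" for t
  have bdd: "bdd_above (S t)" for t
  proof -
    obtain D where "\<forall>z1\<in>Z. \<forall>z2\<in>Z. d z1 z2 \<le> t \<longrightarrow> b z1 z2 \<le> D"
      using ctrl unfolding coarsely_controlled_def by blast
    then have "x \<le> max (max 0 t) D" if "x \<in> S t" for x
      using that unfolding S_def by force
    then show ?thesis by (rule bdd_aboveI)
  qed
  have ge: "max 0 t \<le> \<psi> t" for t
    unfolding \<psi>_def by (rule cSup_upper[OF _ bdd]) (simp add: S_def)
  show thesis
  proof (rule that)
    show "\<psi> \<in> {0..} \<rightarrow> {0..}" using ge by (auto intro: order_trans[OF _ ge])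
    show "mono_on {0..} \<psi>"
    proof (rule mono_onI)
      fix s t :: real assume "s \<le> t"
      show "\<psi> s \<le> \<psi> t"
        unfolding \<psi>_def[of s]
      proof (rule cSup_least)
        show "S s \<noteq> {}" by (simp add: S_def)
        fix x assume "x \<in> S s"
        then consider "x = max 0 s" | "x \<in> S t" using \<open>s \<le> t\<close> unfolding S_def by force
        then show "x \<le> \<psi> t"
        proof cases
          case 1 then show ?thesis using ge[of t] \<open>s \<le> t\<close> by linarith
        next
          case 2 then show ?thesis unfolding \<psi>_def by (rule cSup_upper[OF _ bdd])
        qed
      qed
    qed
    show "filterlim \<psi> at_top at_top"
    proof (rule filterlim_at_top_mono[OF filterlim_ident])
      show "\<forall>\<^sub>F t in at_top. t \<le> \<psi> t" using ge by simp
    qed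
    show "\<forall>z1\<in>Z. \<forall>z2\<in>Z. b z1 z2 \<le> \<psi> (d z1 z2)"
      unfolding \<psi>_def by (intro ballI cSup_upper[OF _ bdd]) (auto simp: S_def)
  qed
qed

text \<open>Dual to the upper bound: \<open>\<phi> t\<close> is the least value of \<open>b\<close>
  on pairs at \<open>d\<close>-distance at least \<open>t\<close>. It diverges because a bound on
  \<open>b\<close> bounds \<open>d\<close>.\<close>

lemma controlled_imp_lower_bound:
  assumes b: "\<And>z1 z2. 0 \<le> b z1 z2" and ctrl: "coarsely_controlled Z d b"
  obtains \<phi> where "\<phi> \<in> {0..} \<rightarrow> {0..}" "mono_on {0..} \<phi>" "filterlim \<phi> at_top at_top"
    "\<forall>z1\<in>Z. \<forall>z2\<in>Z. \<phi> (d z1 z2) \<le> b z1 z2"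
proof -
  \<comment> \<open>If \<open>d\<close> is bounded, no pair is left for large \<open>t\<close>; the
    ray keeps the set nonempty, and its least element still tends to infinity.\<close>
  define S where "S t = {max 0 t..} \<union> {b z1 z2 | z1 z2. z1 \<in> Z \<and> z2 \<in> Z \<and> t \<le> d z1 z2}" for t
  define \<phi> where "\<phi> t = Inf (S t)" for t
  have bdd: "bdd_below (S t)" for t
    by (rule bdd_belowI[of _ 0]) (use b in \<open>auto simp: S_def\<close>)
  have ne: "S t \<noteq> {}" for t unfolding S_def by auto
  show thesis
  proof (rule that)
    show "\<phi> \<in> {0..} \<rightarrow> {0..}"
    proof
      fix t :: real
      show "\<phi> t \<in> {0..}"
        unfolding \<phi>_def atLeast_iff by (rule cInf_greatest[OF ne]) (use b in \<open>auto simp: S_def\<close>)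
    qed
    show "mono_on {0..} \<phi>"
    proof (rule mono_onI)
      fix s t :: real assume "s \<le> t"
      then have "S t \<subseteq> S s" unfolding S_def by (intro Un_mono) (auto intro: order_trans)
      then show "\<phi> s \<le> \<phi> t"
        unfolding \<phi>_def by (rule cInf_superset_mono[OF ne bdd])
    qed
    show "filterlim \<phi> at_top at_top"
      unfolding filterlim_at_top
    proof
      fix N
      obtain D where D: "\<forall>z1\<in>Z. \<forall>z2\<in>Z. b z1 z2 \<le> N \<longrightarrow> d z1 z2 \<le> D"
        using ctrl unfolding coarsely_controlled_def by blast
      \<comment> \<open>Members of the ray are at least \<open>t\<close>, which exceeds
        \<open>N\<close>; a pair with \<open>d\<close> at least \<open>t\<close>, hence above
        \<open>D\<close>, cannot have \<open>b\<close> at most \<open>N\<close>.\<close>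
      have "N \<le> \<phi> t" if "t > max N D" for t
        unfolding \<phi>_def
      proof (rule cInf_greatest[OF ne])
        fix x assume "x \<in> S t"
        then show "N \<le> x" using D that unfolding S_def by force
      qed
      then show "eventually (\<lambda>t. N \<le> \<phi> t) at_top"
        using eventually_gt_at_top[of "max N D"] by (rule eventually_mono[rotated])
    qed
    show "\<forall>z1\<in>Z. \<forall>z2\<in>Z. \<phi> (d z1 z2) \<le> b z1 z2"
      unfolding \<phi>_def by (intro ballI cInf_lower[OF _ bdd]) (auto simp: S_def)
  qed
qed

lemma coarsely_equivalent_iff:
  assumes b: "\<And>z1 z2. 0 \<le> b z1 z2" and d: "\<And>z1 z2. 0 \<le> d z1 z2"
  shows "coarsely_equivalent Z b d \<longleftrightarrow> coarsely_controlled Z b d \<and> coarsely_controlled Z d b"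
proof
  assume "coarsely_equivalent Z b d"
  then obtain \<phi> \<psi> where mono: "mono_on {0..} \<psi>" and lim: "filterlim \<phi> at_top at_top"
    and le: "\<forall>z1\<in>Z. \<forall>z2\<in>Z. \<phi> (d z1 z2) \<le> b z1 z2 \<and> b z1 z2 \<le> \<psi> (d z1 z2)"
    unfolding coarsely_equivalent_def by blast
  show "coarsely_controlled Z b d \<and> coarsely_controlled Z d b"
  proof
    have "b z1 z2 \<le> \<psi> C" if "z1 \<in> Z" "z2 \<in> Z" "d z1 z2 \<le> C" for C z1 z2
    proof -
      have "\<psi> (d z1 z2) \<le> \<psi> C"
        by (rule mono_onD[OF mono]) (use d[of z1 z2] that in auto)
      then show ?thesis using le that by force
    qed
    then show "coarsely_controlled Z b d" unfolding coarsely_controlled_def by blast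
    show "coarsely_controlled Z d b"
      unfolding coarsely_controlled_def
    proof
      fix C
      \<comment> \<open>With \<open>C + 1\<close> instead of \<open>C\<close> the contradiction is
        strict: a pair with \<open>d\<close> at least \<open>T\<close> has \<open>b\<close> above
        \<open>C\<close>.\<close>
      from lim have "eventually (\<lambda>t. C + 1 \<le> \<phi> t) at_top" by (simp add: filterlim_at_top)
      then obtain T where T: "\<And>t. t \<ge> T \<Longrightarrow> C + 1 \<le> \<phi> t"
        unfolding eventually_at_top_linorder by blast
      have "d z1 z2 \<le> T" if "z1 \<in> Z" "z2 \<in> Z" "b z1 z2 \<le> C" for z1 z2
        using T[of "d z1 z2"] le that by force
      then show "\<exists>D. \<forall>z1\<in>Z. \<forall>z2\<in>Z. b z1 z2 \<le> C \<longrightarrow> d z1 z2 \<le> D" by blast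
    qed
  qed
next
  assume "coarsely_controlled Z b d \<and> coarsely_controlled Z d b"
  then show "coarsely_equivalent Z b d"
    unfolding coarsely_equivalent_def
    using controlled_imp_upper_bound[of b Z d] controlled_imp_lower_bound[of b Z d] b by metis
qed

section \<open>Metrics on the double\<close>

lemma double_metrics_nonneg: "d \<in> double_metrics X dX \<Longrightarrow> 0 \<le> d z1 z2"
  unfolding double_metrics_def by (auto intro: Metric_space.nonneg)

lemma double_metrics_commute: "d \<in> double_metrics X dX \<Longrightarrow> d z1 z2 = d z2 z1"
  unfolding double_metrics_def by (auto intro: Metric_space.commute)

lemma double_metrics_copy:
  assumes "d \<in> double_metrics X dX" "x \<in> X" "y \<in> X"
  shows "d (Inl x) (Inl y) = dX x y" "d (Inr x) (Inr y) = dX x y"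
  using assms unfolding double_metrics_def by auto

text \<open>The triangle inequalities of the double in terms of cross distances alone: the first two
  move one endpoint inside its copy, the last two join two points of one copy through a point of the
  other.\<close>

lemma double_metrics_triangle:
  assumes "d \<in> double_metrics X dX" "x \<in> X" "y \<in> X" "z \<in> X"
  shows "d (Inl x) (Inr z) \<le> dX x y + d (Inl y) (Inr z)"
    and "d (Inl x) (Inr z) \<le> d (Inl x) (Inr y) + dX y z"
    and "dX x z \<le> d (Inl x) (Inr y) + d (Inl z) (Inr y)"
    and "dX x z \<le> d (Inl y) (Inr x) + d (Inl y) (Inr z)"
proof -
  have m: "Metric_space (X <+> X) d" using assms unfolding double_metrics_def by auto
  have tri: "d u w \<le> d u v + d v w" if "u \<in> X <+> X" "v \<in> X <+> X" "w \<in> X <+> X" for u v w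
    using Metric_space.triangle[OF m that] .
  note copy = double_metrics_copy[OF assms(1)] and comm = double_metrics_commute[OF assms(1)]
  show "d (Inl x) (Inr z) \<le> dX x y + d (Inl y) (Inr z)"
    using tri[of "Inl x" "Inl y" "Inr z"] assms copy by auto
  show "d (Inl x) (Inr z) \<le> d (Inl x) (Inr y) + dX y z"
    using tri[of "Inl x" "Inr y" "Inr z"] assms copy by auto
  show "dX x z \<le> d (Inl x) (Inr y) + d (Inl z) (Inr y)"
    using tri[of "Inl x" "Inr y" "Inl z"] assms copy comm[of "Inl z" "Inr y"] by auto
  show "dX x z \<le> d (Inl y) (Inr x) + d (Inl y) (Inr z)"
    using tri[of "Inr x" "Inl y" "Inr z"] assms copy comm[of "Inl y" "Inr x"] by auto
qed

lemma double_metrics_lower_bound: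
  assumes "d \<in> double_metrics X dX"
  obtains c where "c > 0" "\<And>x y. x \<in> X \<Longrightarrow> y \<in> X \<Longrightarrow> c \<le> d (Inl x) (Inr y)"
proof
  let ?f = "\<lambda>(x, y). d (Inl x) (Inr y)"
  show "(INF p\<in>X \<times> X. ?f p) > 0" using assms unfolding double_metrics_def by auto
  have "bdd_below (?f ` (X \<times> X))"
    by (rule bdd_belowI[of _ 0]) (auto simp: double_metrics_nonneg[OF assms])
  then show "(INF p\<in>X \<times> X. ?f p) \<le> d (Inl x) (Inr y)" if "x \<in> X" "y \<in> X" for x y
    using cINF_lower[of ?f "X \<times> X" "(x, y)"] that by auto
qed

section \<open>Metrics with prescribed cross distances\<close>

fun double_of :: "('a \<Rightarrow> 'a \<Rightarrow> real) \<Rightarrow> ('a \<Rightarrow> 'a \<Rightarrow> real) \<Rightarrow> 'a + 'a \<Rightarrow> 'a + 'a \<Rightarrow> real" where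
  "double_of dX g (Inl x) (Inl z) = dX x z"
| "double_of dX g (Inr x) (Inr z) = dX x z"
| "double_of dX g (Inl x) (Inr z) = g x z"
| "double_of dX g (Inr z) (Inl x) = g x z"

text \<open>Converse to \<open>double_metrics_triangle\<close>: a cross distance \<open>g\<close>,
  which may be asymmetric, gives a metric once the same four inequalities and a positive lower bound
  hold. Nonnegativity is asked of all points because \<open>Metric_space\<close> asks it off the
  carrier as well.\<close>

lemma double_of_in_double_metrics:
  assumes X: "Metric_space X dX" "X \<noteq> {}"
    and g0: "\<And>x y. 0 \<le> g x y"
    and c: "c > 0" "\<And>x y. x \<in> X \<Longrightarrow> y \<in> X \<Longrightarrow> c \<le> g x y"
    and tri1: "\<And>x y z. x \<in> X \<Longrightarrow> y \<in> X \<Longrightarrow> z \<in> X \<Longrightarrow> g x z \<le> dX x y + g y z"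
    and tri2: "\<And>x y z. x \<in> X \<Longrightarrow> y \<in> X \<Longrightarrow> z \<in> X \<Longrightarrow> g x z \<le> g x y + dX y z"
    and tri3: "\<And>x y z. x \<in> X \<Longrightarrow> y \<in> X \<Longrightarrow> z \<in> X \<Longrightarrow> dX x z \<le> g x y + g z y"
    and tri4: "\<And>x y z. x \<in> X \<Longrightarrow> y \<in> X \<Longrightarrow> z \<in> X \<Longrightarrow> dX x z \<le> g y x + g y z"
  shows "double_of dX g \<in> double_metrics X dX"
proof -
  interpret Metric_space X dX by fact
  let ?d = "double_of dX g"
  have "Metric_space (X <+> X) ?d"
  proof
    fix u v w
    show "0 \<le> ?d u v" by (cases u; cases v) (auto simp: g0)
    show "?d u v = ?d v u" by (cases u; cases v) (auto simp: commute)
    show "?d u v = 0 \<longleftrightarrow> u = v" if "u \<in> X <+> X" "v \<in> X <+> X"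
      using that c by (cases u; cases v) force+
    show "?d u w \<le> ?d u v + ?d v w" if "u \<in> X <+> X" "v \<in> X <+> X" "w \<in> X <+> X"
    proof (cases u; cases v; cases w)
      fix x y z assume "u = Inl x" "v = Inl y" "w = Inl z"
      then show ?thesis using that triangle by auto
    next
      fix x y z assume "u = Inl x" "v = Inl y" "w = Inr z"
      then show ?thesis using that tri1 by auto
    next
      fix x y z assume "u = Inl x" "v = Inr y" "w = Inl z"
      then show ?thesis using that tri3 by auto
    next
      fix x y z assume "u = Inl x" "v = Inr y" "w = Inr z"
      then show ?thesis using that tri2 by auto
    next
      \<comment> \<open>Traversed backwards, this path starts in the first copy, where
        \<open>tri1\<close> applies.\<close>
      fix x y z assume "u = Inr x" "v = Inl y" "w = Inl z"
      then show ?thesis using that tri1[of z y x] commute[of y z] by auto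
    next
      fix x y z assume "u = Inr x" "v = Inl y" "w = Inr z"
      then show ?thesis using that tri4 by auto
    next
      fix x y z assume "u = Inr x" "v = Inr y" "w = Inl z"
      then show ?thesis using that tri2[of z y x] commute[of x y] by auto
    next
      fix x y z assume "u = Inr x" "v = Inr y" "w = Inr z"
      then show ?thesis using that triangle by auto
    qed
  qed
  moreover have "c \<le> (INF (x, y)\<in>X \<times> X. ?d (Inl x) (Inr y))"
    using X(2) c(2) by (intro cINF_greatest) auto
  ultimately show ?thesis using \<open>c > 0\<close> unfolding double_metrics_def by auto
qed

section \<open>Composition of metrics on the double\<close>

lemma double_comp_eq_double_of:
  "double_comp X dX \<rho> d =
    double_of dX (\<lambda>x z. INF y\<in>X. d (Inl x) (Inr y) + \<rho> (Inl y) (Inr z))"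
proof (intro ext)
  fix u v
  show "double_comp X dX \<rho> d u v =
    double_of dX (\<lambda>x z. INF y\<in>X. d (Inl x) (Inr y) + \<rho> (Inl y) (Inr z)) u v"
    by (cases u; cases v) auto
qed

lemma double_comp_le:
  assumes "\<rho> \<in> double_metrics X dX" "d \<in> double_metrics X dX" "y \<in> X"
  shows "double_comp X dX \<rho> d (Inl x) (Inr z) \<le> d (Inl x) (Inr y) + \<rho> (Inl y) (Inr z)"
proof -
  have "bdd_below ((\<lambda>y. d (Inl x) (Inr y) + \<rho> (Inl y) (Inr z)) ` X)"
    by (rule bdd_belowI[of _ 0])
      (auto intro!: add_nonneg_nonneg double_metrics_nonneg[OF assms(1)] double_metrics_nonneg[OF assms(2)])
  then show ?thesis using assms(3) by (auto intro: cINF_lower)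
qed

text \<open>The infimum over intermediate points may fail to be attained; a point optimal up to
  \<open>e\<close> replaces a minimizer in what follows.\<close>

lemma double_comp_approx:
  assumes "X \<noteq> {}" "e > 0"
  obtains y where "y \<in> X"
    "d (Inl x) (Inr y) + \<rho> (Inl y) (Inr z) < double_comp X dX \<rho> d (Inl x) (Inr z) + e"
proof -
  let ?S = "(\<lambda>y. d (Inl x) (Inr y) + \<rho> (Inl y) (Inr z)) ` X"
  have "\<exists>s\<in>?S. s < Inf ?S + e" by (rule cInf_lessD) (use assms in auto)
  then show ?thesis using that by auto
qed

text \<open>Each inequality for the composite cross distance \<open>g\<close> follows from those of
  the factors along near-optimal paths; the error \<open>e\<close> is then arbitrary. When two paths
  are chosen, each gets \<open>e / 2\<close>.\<close>

lemma double_comp_in_double_metrics: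
  assumes X: "Metric_space X dX" "X \<noteq> {}"
    and \<rho>: "\<rho> \<in> double_metrics X dX" and d: "d \<in> double_metrics X dX"
  shows "double_comp X dX \<rho> d \<in> double_metrics X dX"
proof -
  interpret Metric_space X dX by fact
  define g where "g x z = double_comp X dX \<rho> d (Inl x) (Inr z)" for x z
  have g_alt: "g = (\<lambda>x z. INF y\<in>X. d (Inl x) (Inr y) + \<rho> (Inl y) (Inr z))"
    unfolding g_def by simp
  have le: "g x z \<le> d (Inl x) (Inr y) + \<rho> (Inl y) (Inr z)" if "y \<in> X" for x y z
    using double_comp_le[OF \<rho> d that] unfolding g_def .
  have approx: "\<exists>y\<in>X. d (Inl x) (Inr y) + \<rho> (Inl y) (Inr z) < g x z + e" if "e > 0" for x z e
    using double_comp_approx[OF X(2) that] unfolding g_def by metis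
  note nonneg = double_metrics_nonneg[OF \<rho>] double_metrics_nonneg[OF d]
  note tri_\<rho> = double_metrics_triangle[OF \<rho>] and tri_d = double_metrics_triangle[OF d]
  obtain c where c: "c > 0" "\<And>x y. x \<in> X \<Longrightarrow> y \<in> X \<Longrightarrow> c \<le> d (Inl x) (Inr y)"
    using double_metrics_lower_bound[OF d] by blast
  have "double_of dX g \<in> double_metrics X dX"
  proof (rule double_of_in_double_metrics[OF X _ c(1)])
    fix x z show "0 \<le> g x z"
      unfolding g_alt by (rule cINF_greatest[OF X(2)]) (simp add: nonneg)
  next
    fix x z assume "x \<in> X" "z \<in> X"
    then show "c \<le> g x z"
      unfolding g_alt by (intro cINF_greatest[OF X(2)]) (use c nonneg in \<open>simp add: add_increasing2\<close>)
  next
    fix x y z assume xyz: "x \<in> X" "y \<in> X" "z \<in> X"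
    show "g x z \<le> dX x y + g y z"
    proof (rule field_le_epsilon)
      fix e :: real assume "e > 0"
      then obtain u where u: "u \<in> X" "d (Inl y) (Inr u) + \<rho> (Inl u) (Inr z) < g y z + e"
        using approx by blast
      show "g x z \<le> dX x y + g y z + e"
        using u le[of u x z] tri_d(1)[of x y u] xyz by linarith
    qed
    show "g x z \<le> g x y + dX y z"
    proof (rule field_le_epsilon)
      fix e :: real assume "e > 0"
      then obtain u where u: "u \<in> X" "d (Inl x) (Inr u) + \<rho> (Inl u) (Inr y) < g x y + e"
        using approx by blast
      show "g x z \<le> g x y + dX y z + e"
        using u le[of u x z] tri_\<rho>(2)[of u y z] xyz by linarith
    qed
    show "dX x z \<le> g x y + g z y"
    proof (rule field_le_epsilon)
      fix e :: real assume "e > 0"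
      then have "e / 2 > 0" by simp
      then obtain u v where u: "u \<in> X" "d (Inl x) (Inr u) + \<rho> (Inl u) (Inr y) < g x y + e / 2"
        and v: "v \<in> X" "d (Inl z) (Inr v) + \<rho> (Inl v) (Inr y) < g z y + e / 2"
        using approx by meson
      \<comment> \<open>Both paths end at \<open>y\<close>, so \<open>\<rho>\<close> bounds the
        distance of \<open>u\<close> and \<open>v\<close>; \<open>d\<close> carries this bound back
        to \<open>x\<close> and \<open>z\<close>.\<close>
      have "dX x z \<le> d (Inl x) (Inr u) + d (Inl z) (Inr u)" using tri_d(3) u xyz by blast
      moreover have "d (Inl z) (Inr u) \<le> d (Inl z) (Inr v) + dX v u" using tri_d(2) u v xyz by blast
      moreover have "dX v u \<le> \<rho> (Inl v) (Inr y) + \<rho> (Inl u) (Inr y)" using tri_\<rho>(3) u v xyz by blast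
      ultimately show "dX x z \<le> g x y + g z y + e" using u v by linarith
    qed
    show "dX x z \<le> g y x + g y z"
    proof (rule field_le_epsilon)
      fix e :: real assume "e > 0"
      then have "e / 2 > 0" by simp
      then obtain u v where u: "u \<in> X" "d (Inl y) (Inr u) + \<rho> (Inl u) (Inr x) < g y x + e / 2"
        and v: "v \<in> X" "d (Inl y) (Inr v) + \<rho> (Inl v) (Inr z) < g y z + e / 2"
        using approx by meson
      \<comment> \<open>The mirror image: both paths start at \<open>y\<close>, so \<open>d\<close>
        compares \<open>u\<close> with \<open>v\<close>, and \<open>\<rho>\<close> carries the bound
        on to \<open>x\<close> and \<open>z\<close>.\<close>
      have "dX x z \<le> \<rho> (Inl u) (Inr x) + \<rho> (Inl u) (Inr z)" using tri_\<rho>(4) u xyz by blast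
      moreover have "\<rho> (Inl u) (Inr z) \<le> dX u v + \<rho> (Inl v) (Inr z)" using tri_\<rho>(1) u v xyz by blast
      moreover have "dX u v \<le> d (Inl y) (Inr u) + d (Inl y) (Inr v)" using tri_d(4) u v xyz by blast
      ultimately show "dX x z \<le> g y x + g y z + e" using u v by linarith
    qed
  qed
  then show ?thesis unfolding g_alt double_comp_eq_double_of .
qed

section \<open>Coarse classes of metrics on the double\<close>

lemma coarse_rel_iff:
  "(b, d) \<in> coarse_rel X dX \<longleftrightarrow> b \<in> double_metrics X dX \<and> d \<in> double_metrics X dX \<and>
    coarsely_controlled (X <+> X) b d \<and> coarsely_controlled (X <+> X) d b"
  unfolding coarse_rel_def using coarsely_equivalent_iff[of b d "X <+> X"]
  by (auto dest: double_metrics_nonneg)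

lemma equiv_coarse_rel: "equiv (double_metrics X dX) (coarse_rel X dX)"
proof (rule equivI)
  show "coarse_rel X dX \<subseteq> double_metrics X dX \<times> double_metrics X dX"
    by (auto simp: coarse_rel_iff)
  show "refl_on (double_metrics X dX) (coarse_rel X dX)"
    by (auto simp: refl_on_def coarse_rel_iff coarsely_controlled_refl)
  show "sym (coarse_rel X dX)" by (auto simp: sym_def coarse_rel_iff)
  show "trans (coarse_rel X dX)"
    by (auto simp: trans_def coarse_rel_iff intro: coarsely_controlled_trans)
qed

text \<open>Inside a copy both metrics equal \<open>dX\<close>, so \<open>C\<close> bounds itself
  there; symmetry reduces the remaining pairs to those from the first copy to the second.\<close>

lemma coarsely_controlled_doubleI:
  assumes b: "b \<in> double_metrics X dX" and d: "d \<in> double_metrics X dX"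
    and cross: "\<And>C. \<exists>D. \<forall>x\<in>X. \<forall>y\<in>X. d (Inl x) (Inr y) \<le> C \<longrightarrow> b (Inl x) (Inr y) \<le> D"
  shows "coarsely_controlled (X <+> X) b d"
  unfolding coarsely_controlled_def
proof
  fix C
  obtain D where D: "\<forall>x\<in>X. \<forall>y\<in>X. d (Inl x) (Inr y) \<le> C \<longrightarrow> b (Inl x) (Inr y) \<le> D"
    using cross by blast
  have "b u v \<le> max C D" if uv: "u \<in> X <+> X" "v \<in> X <+> X" and le: "d u v \<le> C" for u v
  proof (cases u; cases v)
    fix x y assume "u = Inr x" "v = Inl y"
    then have "d (Inl y) (Inr x) \<le> C" using le double_metrics_commute[OF d, of u v] by simp
    then have "b (Inl y) (Inr x) \<le> D" using D uv \<open>u = _\<close> \<open>v = _\<close> by auto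
    then show ?thesis using double_metrics_commute[OF b, of u v] \<open>u = _\<close> \<open>v = _\<close> by simp
  qed (use uv le D double_metrics_copy[OF b] double_metrics_copy[OF d] in force)+
  then show "\<exists>D. \<forall>u\<in>X <+> X. \<forall>v\<in>X <+> X. d u v \<le> C \<longrightarrow> b u v \<le> D" by blast
qed

section \<open>Commutativity\<close>

text \<open>By \<open>diag\<close>, a short path from \<open>x\<close> through \<open>y\<close> to
  \<open>z\<close> has all three points within bounded distance in \<open>X\<close>. Each factor can
  therefore be evaluated on the other leg at bounded cost, and the same \<open>y\<close> serves for
  the reversed composition.\<close>

lemma coarsely_diagonal_controlled:
  assumes X: "Metric_space X dX" "X \<noteq> {}"
    and diag: "\<And>d C. d \<in> double_metrics X dX \<Longrightarrow>
      \<exists>R. \<forall>x\<in>X. \<forall>y\<in>X. d (Inl x) (Inr y) \<le> C \<longrightarrow> dX x y \<le> R"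
    and \<rho>: "\<rho> \<in> double_metrics X dX" and d: "d \<in> double_metrics X dX"
  shows "coarsely_controlled (X <+> X) (double_comp X dX d \<rho>) (double_comp X dX \<rho> d)"
proof (rule coarsely_controlled_doubleI)
  show "double_comp X dX d \<rho> \<in> double_metrics X dX" "double_comp X dX \<rho> d \<in> double_metrics X dX"
    using double_comp_in_double_metrics X \<rho> d by blast+
  fix C
  \<comment> \<open>The added 1 is the error of the near-optimal \<open>y\<close> chosen below; by
    nonnegativity it bounds each leg separately.\<close>
  obtain R where R: "\<And>x y. x \<in> X \<Longrightarrow> y \<in> X \<Longrightarrow> d (Inl x) (Inr y) \<le> C + 1 \<Longrightarrow> dX x y \<le> R"
    using diag[OF d] by meson
  obtain R' where R': "\<And>x y. x \<in> X \<Longrightarrow> y \<in> X \<Longrightarrow> \<rho> (Inl x) (Inr y) \<le> C + 1 \<Longrightarrow> dX x y \<le> R'"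
    using diag[OF \<rho>] by meson
  have "double_comp X dX d \<rho> (Inl x) (Inr z) \<le> 2 * (C + 1 + R + R')"
    if xz: "x \<in> X" "z \<in> X" and le: "double_comp X dX \<rho> d (Inl x) (Inr z) \<le> C" for x z
  proof -
    obtain y where y: "y \<in> X"
      and "d (Inl x) (Inr y) + \<rho> (Inl y) (Inr z) < double_comp X dX \<rho> d (Inl x) (Inr z) + 1"
      by (rule double_comp_approx[OF X(2) zero_less_one])
    then have small: "d (Inl x) (Inr y) \<le> C + 1" "\<rho> (Inl y) (Inr z) \<le> C + 1"
      using le double_metrics_nonneg[OF d, of "Inl x" "Inr y"]
        double_metrics_nonneg[OF \<rho>, of "Inl y" "Inr z"] by linarith+
    have near: "dX x y \<le> R" "dX y z \<le> R'" using R R' small xz y by blast+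
    \<comment> \<open>Both endpoints of the short pair \<open>y\<close>, \<open>z\<close> are
      shifted to \<open>x\<close>, \<open>y\<close>, at cost \<open>R + R'\<close>; the pair for
      \<open>d\<close> is shifted the opposite way. Each leg is thus at most
      \<open>C + 1 + R + R'\<close>.\<close>
    have "\<rho> (Inl x) (Inr y) \<le> dX x y + (\<rho> (Inl y) (Inr z) + dX z y)"
      using double_metrics_triangle(1)[OF \<rho>, of x y y] double_metrics_triangle(2)[OF \<rho>, of y z y] xz y
      by linarith
    moreover have "d (Inl y) (Inr z) \<le> dX y x + (d (Inl x) (Inr y) + dX y z)"
      using double_metrics_triangle(1)[OF d, of y x z] double_metrics_triangle(2)[OF d, of x y z] xz y
      by linarith
    moreover have "dX z y = dX y z" "dX y x = dX x y" using Metric_space.commute[OF X(1)] by auto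
    ultimately show ?thesis
      using double_comp_le[OF d \<rho> y, of x z] small near by argo
  qed
  then show "\<exists>D. \<forall>x\<in>X. \<forall>z\<in>X. double_comp X dX \<rho> d (Inl x) (Inr z) \<le> C \<longrightarrow>
      double_comp X dX d \<rho> (Inl x) (Inr z) \<le> D" by blast
qed

text \<open>The product is a union over representatives of both factors. Control in both directions,
  from the previous lemma with \<open>\<rho>\<close> and \<open>d\<close> exchanged, identifies the
  terms one by one, and the two unions are then swapped.\<close>

lemma coarsely_diagonal_commutative:
  assumes X: "Metric_space X dX" "X \<noteq> {}"
    and diag: "\<And>d C. d \<in> double_metrics X dX \<Longrightarrow>
      \<exists>R. \<forall>x\<in>X. \<forall>y\<in>X. d (Inl x) (Inr y) \<le> C \<longrightarrow> dX x y \<le> R"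
    and A: "A \<in> carrier (metric_semigroup X dX)" and B: "B \<in> carrier (metric_semigroup X dX)"
  shows "A \<otimes>\<^bsub>metric_semigroup X dX\<^esub> B = B \<otimes>\<^bsub>metric_semigroup X dX\<^esub> A"
proof -
  have sub: "A \<subseteq> double_metrics X dX" "B \<subseteq> double_metrics X dX"
    using A B in_quotient_imp_subset[OF equiv_coarse_rel]
    unfolding metric_semigroup_def by auto
  have eq: "coarse_rel X dX `` {double_comp X dX \<rho> d} = coarse_rel X dX `` {double_comp X dX d \<rho>}"
    if "\<rho> \<in> A" "d \<in> B" for \<rho> d
  proof (rule equiv_class_eq[OF equiv_coarse_rel])
    have "\<rho> \<in> double_metrics X dX" "d \<in> double_metrics X dX" using that sub by auto
    then show "(double_comp X dX \<rho> d, double_comp X dX d \<rho>) \<in> coarse_rel X dX"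
      unfolding coarse_rel_iff
      using coarsely_diagonal_controlled[OF X diag] double_comp_in_double_metrics[OF X] by simp
  qed
  have "(\<Union>\<rho>\<in>A. \<Union>d\<in>B. coarse_rel X dX `` {double_comp X dX \<rho> d}) =
      (\<Union>\<rho>\<in>A. \<Union>d\<in>B. coarse_rel X dX `` {double_comp X dX d \<rho>})"
    by (intro SUP_cong refl eq)
  also have "\<dots> = (\<Union>d\<in>B. \<Union>\<rho>\<in>A. coarse_rel X dX `` {double_comp X dX d \<rho>})"
    by blast
  finally show ?thesis unfolding metric_semigroup_def by simp
qed

text \<open>Commutativity passes to the image of a homomorphism; it is the invariant that separates
  the two semigroups.\<close>

lemma commutative_iso:
  assumes iso: "G \<cong> H"
    and comm: "\<And>x y. x \<in> carrier G \<Longrightarrow> y \<in> carrier G \<Longrightarrow> x \<otimes>\<^bsub>G\<^esub> y = y \<otimes>\<^bsub>G\<^esub> x"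
    and "a \<in> carrier H" "b \<in> carrier H"
  shows "a \<otimes>\<^bsub>H\<^esub> b = b \<otimes>\<^bsub>H\<^esub> a"
proof -
  obtain h where h: "h \<in> hom G H" and "h ` carrier G = carrier H"
    using iso unfolding is_iso_def iso_def bij_betw_def by blast
  then obtain x y where "x \<in> carrier G" "y \<in> carrier G" "a = h x" "b = h y"
    using assms(3,4) by blast
  then show ?thesis using hom_mult[OF h] comm by metis
qed

section \<open>The two spaces\<close>

abbreviation line_dist :: "real \<Rightarrow> real \<Rightarrow> real" where
  "line_dist x y \<equiv> \<bar>x - y\<bar>"

definition skew_set :: "real set" where
  "skew_set = insert 0 (range (\<lambda>n. (- 2) ^ n))"

definition symmetric_set :: "real set" where
  "symmetric_set = insert 0 (range (\<lambda>n. 4 ^ n) \<union> range (\<lambda>n. - (4 ^ n)))"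

lemma Metric_space_line: "Metric_space S line_dist"
  by unfold_locales auto

text \<open>The smaller power is at most half of the larger.\<close>

lemma power2_gap: "n < m \<Longrightarrow> (2::real) ^ m \<le> 2 * (2 ^ m - 2 ^ n)"
  using power_increasing[of "Suc n" m "2::real"] by simp

text \<open>The absolute values of distinct points differ by at least half of the larger one, while
  \<open>\<bar>x - y\<bar>\<close> is at most twice the larger one; this gives the factor 4.\<close>

lemma skew_set_gap:
  assumes "x \<in> skew_set" "y \<in> skew_set"
  shows "\<bar>x - y\<bar> \<le> 4 * \<bar>\<bar>x\<bar> - \<bar>y\<bar>\<bar>"
proof -
  have pow: "\<bar>(- 2) ^ n\<bar> = (2::real) ^ n" for n by (simp add: power_abs)
  have "x = y \<or> max \<bar>x\<bar> \<bar>y\<bar> \<le> 2 * \<bar>\<bar>x\<bar> - \<bar>y\<bar>\<bar>"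
  proof (cases "x = 0 \<or> y = 0")
    case True then show ?thesis by auto
  next
    case False
    then obtain m n where mn: "x = (- 2) ^ m" "y = (- 2) ^ n"
      using assms unfolding skew_set_def by auto
    consider "m = n" | "n < m" | "m < n" by linarith
    then show ?thesis
    proof cases
      case 1 then show ?thesis using mn by simp
    next
      case 2
      from power2_gap[OF 2] have "\<bar>x\<bar> \<le> 2 * (\<bar>x\<bar> - \<bar>y\<bar>)" unfolding mn pow .
      then have "max \<bar>x\<bar> \<bar>y\<bar> \<le> 2 * \<bar>\<bar>x\<bar> - \<bar>y\<bar>\<bar>" by (auto simp: max_def abs_if[of "\<bar>x\<bar> - \<bar>y\<bar>"])
      then show ?thesis ..
    next
      case 3
      from power2_gap[OF 3] have "\<bar>y\<bar> \<le> 2 * (\<bar>y\<bar> - \<bar>x\<bar>)" unfolding mn pow .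
      then have "max \<bar>x\<bar> \<bar>y\<bar> \<le> 2 * \<bar>\<bar>x\<bar> - \<bar>y\<bar>\<bar>" by (auto simp: max_def abs_if[of "\<bar>x\<bar> - \<bar>y\<bar>"])
      then show ?thesis ..
    qed
  qed
  then show ?thesis
  proof
    assume "max \<bar>x\<bar> \<bar>y\<bar> \<le> 2 * \<bar>\<bar>x\<bar> - \<bar>y\<bar>\<bar>"
    then show ?thesis using abs_triangle_ineq4[of x y] by simp
  qed simp
qed

lemma skew_set_coarsely_diagonal:
  assumes d: "d \<in> double_metrics skew_set line_dist"
  shows "\<exists>R. \<forall>x\<in>skew_set. \<forall>y\<in>skew_set. d (Inl x) (Inr y) \<le> C \<longrightarrow> line_dist x y \<le> R"
proof -
  define K where "K = d (Inl 0) (Inr 0)"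
  have 0: "0 \<in> skew_set" unfolding skew_set_def by simp
  have "line_dist x y \<le> 4 * (C + K)"
    if xy: "x \<in> skew_set" "y \<in> skew_set" and le: "d (Inl x) (Inr y) \<le> C" for x y
  proof -
    note tri = double_metrics_triangle[OF d]
    \<comment> \<open>The distance from \<open>x\<close> to 0 is estimated along the path from
      \<open>x\<close> through \<open>y'\<close> and \<open>0'\<close> to 0; the next bound uses the
      path from \<open>y'\<close> through \<open>x\<close> and 0 to \<open>0'\<close>.\<close>
    have "\<bar>x\<bar> \<le> d (Inl x) (Inr y) + (\<bar>y\<bar> + K)"
      using tri(3)[of x y 0] tri(2)[of 0 0 y] xy 0 unfolding K_def by auto
    moreover have "\<bar>y\<bar> \<le> d (Inl x) (Inr y) + (\<bar>x\<bar> + K)"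
      using tri(4)[of y x 0] tri(1)[of x 0 0] xy 0 unfolding K_def by auto
    ultimately have "\<bar>\<bar>x\<bar> - \<bar>y\<bar>\<bar> \<le> C + K" using le by (intro abs_leI) simp_all
    then show ?thesis using skew_set_gap[OF xy] by argo
  qed
  then show ?thesis by blast
qed

lemma quasi_isometric_skew_symmetric:
  "quasi_isometric skew_set line_dist symmetric_set line_dist"
proof -
  define f where "f x = (if x \<ge> 0 then x else x / 2)" for x :: real
  \<comment> \<open>This rules out the nonnegative branch of \<open>f\<close> at the points
    \<open>- 2 * 4 ^ k\<close>.\<close>
  have pow_le: "\<not> (4::real) ^ k \<le> 0" for k by (simp add: not_le)
  have even: "(- 2) ^ (2 * k) = (4::real) ^ k" for k by (simp add: power_mult)
  have odd: "(- 2) ^ Suc (2 * k) = - 2 * (4::real) ^ k" for k by (simp add: power_mult)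
  have skew_pow: "(- 2) ^ n \<in> skew_set" for n by (simp add: skew_set_def)
  have "f x \<in> symmetric_set" if x: "x \<in> skew_set" for x
  proof (cases "x = 0")
    case True then show ?thesis by (simp add: f_def symmetric_set_def)
  next
    case False
    then obtain n where n: "x = (- 2) ^ n" using x unfolding skew_set_def by auto
    obtain k where "n = 2 * k \<or> n = Suc (2 * k)" by (metis evenE oddE Suc_eq_plus1)
    then have "x = 4 ^ k \<or> x = - 2 * 4 ^ k" using n even odd by metis
    then have "f x = 4 ^ k \<or> f x = - (4 ^ k)" by (auto simp: f_def pow_le)
    then show ?thesis unfolding symmetric_set_def by auto
  qed
  then have map: "f \<in> skew_set \<rightarrow> symmetric_set" by blast
  \<comment> \<open>\<open>f\<close> is increasing and piecewise linear with slopes 1 and 1/2, so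
    \<open>L = 2\<close> and \<open>C = 0\<close> suffice; the zeros fit the shape of the
    definition.\<close>
  have lip: "\<bar>x - y\<bar> / 2 - 0 \<le> \<bar>f x - f y\<bar>" "\<bar>f x - f y\<bar> \<le> 2 * \<bar>x - y\<bar> + 0" for x y
    unfolding f_def abs_if by argo+
  have onto: "\<exists>x\<in>skew_set. f x = y" if y: "y \<in> symmetric_set" for y
  proof -
    consider "y = 0" | k where "y = 4 ^ k" | k where "y = - (4 ^ k)"
      using y unfolding symmetric_set_def by auto
    then show ?thesis
    proof cases
      case 1 then show ?thesis by (intro bexI[of _ 0]) (auto simp: f_def skew_set_def)
    next
      case (2 k)
      then have "f (4 ^ k) = y" by (simp add: f_def)
      moreover have "4 ^ k \<in> skew_set" using skew_pow[of "2 * k"] unfolding even .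
      ultimately show ?thesis by (rule bexI)
    next
      case (3 k)
      then have "f (- 2 * 4 ^ k) = y" by (simp add: f_def pow_le)
      moreover have "- 2 * 4 ^ k \<in> skew_set" using skew_pow[of "Suc (2 * k)"] unfolding odd .
      ultimately show ?thesis by (rule bexI)
    qed
  qed
  show ?thesis
    unfolding quasi_isometric_def
  proof (intro bexI[OF _ map] exI conjI ballI)
    show "\<bar>x - y\<bar> / 2 - 0 \<le> \<bar>f x - f y\<bar>" "\<bar>f x - f y\<bar> \<le> 2 * \<bar>x - y\<bar> + 0" for x y
      by (rule lip)+
    show "\<exists>x\<in>skew_set. \<bar>f x - y\<bar> \<le> 0" if "y \<in> symmetric_set" for y
      using onto[OF that] by auto
  qed simp_all
qed

text \<open>The cross distance is \<open>\<bar>x - (- y)\<bar> + 1\<close>: each \<open>x\<close>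
  lies at distance 1 from the second copy of \<open>- x\<close>.\<close>

abbreviation reflection_metric :: "real + real \<Rightarrow> real + real \<Rightarrow> real" where
  "reflection_metric \<equiv> double_of line_dist (\<lambda>x y. \<bar>x + y\<bar> + 1)"

text \<open>
  The cross distance is the infimum of \<open>\<bar>x - p\<bar> + 1 + \<bar>p - y\<bar>\<close> over the real numbers \<open>p \<ge> 0\<close>.
\<close>

abbreviation half_line_metric :: "real + real \<Rightarrow> real + real \<Rightarrow> real" where
  "half_line_metric \<equiv> double_of line_dist (\<lambda>x y. max \<bar>x - y\<bar> (- x - y) + 1)"

lemma reflection_metric_in_double_metrics:
  "S \<noteq> {} \<Longrightarrow> reflection_metric \<in> double_metrics S line_dist"
  \<comment> \<open>The 1 is the lower bound \<open>c\<close>, read off from the constant summand of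
    the cross distance.\<close>
  by (rule double_of_in_double_metrics[OF Metric_space_line, of _ _ 1]) (assumption | linarith)+

lemma half_line_metric_in_double_metrics:
  "S \<noteq> {} \<Longrightarrow> half_line_metric \<in> double_metrics S line_dist"
  by (rule double_of_in_double_metrics[OF Metric_space_line, of _ _ 1]) (assumption | linarith)+

text \<open>Restricting to the positive half and then reflecting takes \<open>4 ^ n\<close> to
  \<open>- (4 ^ n)\<close> at bounded cost. In the other order, the half-line metric must reach the
  negative point \<open>- (4 ^ n)\<close>, which is expensive from everywhere.\<close>

lemma symmetric_set_not_commutative:
  defines "M \<equiv> metric_semigroup symmetric_set line_dist"
  shows "\<exists>A\<in>carrier M. \<exists>B\<in>carrier M. A \<otimes>\<^bsub>M\<^esub> B \<noteq> B \<otimes>\<^bsub>M\<^esub> A"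
proof -
  let ?R = "coarse_rel symmetric_set line_dist" and ?D = "double_metrics symmetric_set line_dist"
  let ?comp = "double_comp symmetric_set line_dist"
  let ?\<sigma> = reflection_metric and ?p = half_line_metric
  let ?A = "?R `` {?\<sigma>}" and ?B = "?R `` {?p}"
  have ne: "symmetric_set \<noteq> {}" unfolding symmetric_set_def by simp
  have mem: "?\<sigma> \<in> ?D" "?p \<in> ?D"
    using reflection_metric_in_double_metrics[OF ne] half_line_metric_in_double_metrics[OF ne] by auto
  have self: "(u, u) \<in> ?R" if "u \<in> ?D" for u
    using that by (simp add: coarse_rel_iff coarsely_controlled_refl)
  have carr: "?A \<in> carrier M" "?B \<in> carrier M"
    using mem unfolding M_def metric_semigroup_def by (auto intro: quotientI)
  have in_AB: "?comp ?\<sigma> ?p \<in> ?A \<otimes>\<^bsub>M\<^esub> ?B"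
    using self[OF mem(1)] self[OF mem(2)]
      self[OF double_comp_in_double_metrics[OF Metric_space_line ne mem]]
    unfolding M_def metric_semigroup_def by auto
  \<comment> \<open>The product is a union over all representatives, so membership is refuted for
    arbitrary \<open>d\<close> in the class of \<open>?p\<close> and \<open>\<rho>\<close> in the
    class of \<open>?\<sigma>\<close>, with \<open>\<rho>\<close> applied first.\<close>
  have not_in_BA: "?comp ?\<sigma> ?p \<notin> ?B \<otimes>\<^bsub>M\<^esub> ?A"
  proof
    assume "?comp ?\<sigma> ?p \<in> ?B \<otimes>\<^bsub>M\<^esub> ?A"
    then obtain d \<rho> where d: "(?p, d) \<in> ?R" and \<rho>: "(?\<sigma>, \<rho>) \<in> ?R"
      and rel: "(?comp d \<rho>, ?comp ?\<sigma> ?p) \<in> ?R"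
      unfolding M_def metric_semigroup_def by auto
    have dD: "d \<in> ?D" and \<rho>D: "\<rho> \<in> ?D" using d \<rho> by (auto simp: coarse_rel_iff)
    \<comment> \<open>The 2 is the length of the path that goes from \<open>4 ^ n\<close> to its own
      copy under \<open>?p\<close> and on to \<open>- (4 ^ n)\<close> under
      \<open>?\<sigma>\<close>; each leg has length 1.\<close>
    obtain C where C: "\<And>u v. u \<in> symmetric_set <+> symmetric_set \<Longrightarrow>
        v \<in> symmetric_set <+> symmetric_set \<Longrightarrow> ?comp ?\<sigma> ?p u v \<le> 2 \<Longrightarrow> ?comp d \<rho> u v \<le> C"
      using rel unfolding coarse_rel_iff coarsely_controlled_def by meson
    obtain C' where C': "\<And>u v. u \<in> symmetric_set <+> symmetric_set \<Longrightarrow>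
        v \<in> symmetric_set <+> symmetric_set \<Longrightarrow> d u v \<le> C + 1 \<Longrightarrow> ?p u v \<le> C'"
      using d unfolding coarse_rel_iff coarsely_controlled_def by meson
    have bound: "4 ^ n \<le> C'" for n :: nat
    proof -
      let ?x = "4 ^ n :: real"
      have x: "?x \<in> symmetric_set" "- ?x \<in> symmetric_set" unfolding symmetric_set_def by auto
      have "?comp ?\<sigma> ?p (Inl ?x) (Inr (- ?x)) \<le> 2"
        using double_comp_le[OF mem x(1), of ?x "- ?x"] by simp
      then have le: "?comp d \<rho> (Inl ?x) (Inr (- ?x)) \<le> C" using C x by blast
      obtain y where y: "y \<in> symmetric_set" and
        "\<rho> (Inl ?x) (Inr y) + d (Inl y) (Inr (- ?x)) < ?comp d \<rho> (Inl ?x) (Inr (- ?x)) + 1"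
        by (rule double_comp_approx[OF ne zero_less_one])
      then have "d (Inl y) (Inr (- ?x)) \<le> C + 1"
        using le double_metrics_nonneg[OF \<rho>D, of "Inl ?x" "Inr y"] by linarith
      then have "?p (Inl y) (Inr (- ?x)) \<le> C'" using C' x y by blast
      \<comment> \<open>The numbers \<open>4 ^ n + y\<close> and \<open>4 ^ n - y\<close> have mean
        \<open>4 ^ n\<close>, so their maximum is at least \<open>4 ^ n\<close> whatever
        \<open>y\<close> is.\<close>
      then show ?thesis by auto
    qed
    obtain n where "C' < 4 ^ n" using real_arch_pow[of 4 C'] by auto
    then show False using bound[of n] by linarith
  qed
  show ?thesis
  proof (intro bexI notI)
    assume eq: "?A \<otimes>\<^bsub>M\<^esub> ?B = ?B \<otimes>\<^bsub>M\<^esub> ?A"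
    show False using in_AB not_in_BA unfolding eq by contradiction
  qed (rule carr)+
qed

theorem theorem5p2:
  "\<exists>(X :: real set) dX (Y :: real set) dY.
     X \<noteq> {} \<and> Metric_space X dX \<and> Y \<noteq> {} \<and> Metric_space Y dY \<and>
     quasi_isometric X dX Y dY \<and>
     \<not> metric_semigroup X dX \<cong> metric_semigroup Y dY"
proof (intro exI conjI)
  show ne: "skew_set \<noteq> {}" and "symmetric_set \<noteq> {}"
    by (simp_all add: skew_set_def symmetric_set_def)
  show "Metric_space skew_set line_dist" "Metric_space symmetric_set line_dist"
    by (rule Metric_space_line)+
  show "quasi_isometric skew_set line_dist symmetric_set line_dist"
    by (rule quasi_isometric_skew_symmetric)
  show "\<not> metric_semigroup skew_set line_dist \<cong> metric_semigroup symmetric_set line_dist"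
  proof
    assume iso: "metric_semigroup skew_set line_dist \<cong> metric_semigroup symmetric_set line_dist"
    note comm = coarsely_diagonal_commutative[OF Metric_space_line ne skew_set_coarsely_diagonal]
    show False
      using symmetric_set_not_commutative commutative_iso[OF iso comm] by blast
  qed
qed

end
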